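(* Let $t\in[0,1]$ and put $C_t[0,1]=\{\tilde h:\ \tilde h(x)=h(x)\chi_{C_t}(x)\ (x\in[0,1]),\ h\in C[0,1]\}$, where $C[0,1]$ is the set of continuous real-valued functions on $[0,1]$ and $\chi_{C_t}$ is the indicator function of $C_t$. Then a sequence $(x_n)_{n\in\mathbb{N}}\in[0,1]^{\infty}$ is $\lambda_t$-uniformly distributed if and only if $$\lim_{N\to\infty}\frac{1}{N}\sum_{n=1}^{N}\tilde h(x_n)=\int_{[0,1]}\tilde h(x)\,d\lambda_t(x)$$ for each $\tilde h\in C_t[0,1]$.
   Context: Let $\lambda$ be Lebesgue measure on $\mathbb{R}$ and $\mathfrak{c}=2^{\aleph_0}$. Fix a family $(X_t)_{t\in[0,1]}$ of subsets of $\mathbb{R}$ such that: (1) $X_t\cap X_{t'}=\emptyset$ for $t\neq t'$; (2) for every $t\in[0,1]$ and every closed $F\subseteq\mathbb{R}$ with $\lambda(F)>0$, $\mathrm{card}(X_t\cap F)=\mathfrak{c}$; (3) for every $I'\subseteq[0,1]$ and $g\in\mathbb{R}$, $\mathrm{card}\big((g+\bigcup_{i\in I'}X_i)\,\triangle\,\bigcup_{i\in I'}X_i\big)<\mathfrak{c}$. (Such a family is known to exist.) Let $S(\mathbb{R})$ be the shift-invariant $\sigma$-algebra of subsets of $\mathbb{R}$ generated by all Lebesgue measurable sets, all sets of cardinality $<\mathfrak{c}$, and all the sets $X_t$, $t\in[0,1]$. For $t\in[0,1]$ let $\mu_t$ be a shift-invariant measure on $S(\mathbb{R})$ that extends $\lambda$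 and satisfies $\mu_t(\mathbb{R}\setminus X_t)=0$ (such measures exist). Let $\lambda_t$ be the restriction of $\mu_t$ to the $\sigma$-algebra $S[0,1]=\{Y\cap[0,1]:Y\in S(\mathbb{R})\}$ of subsets of $[0,1]$, and let $C_t=X_t\cap[0,1]$. Thus $\lambda_t$ is a probability measure on $[0,1]$ with $\lambda_t([0,1]\setminus C_t)=0$. Here $[0,1]^{\infty}=[0,1]^{\mathbb{N}}$, $\mathbb{N}=\{1,2,\dots\}$. A sequence $(x_k)_{k\in\mathbb{N}}\in[0,1]^{\infty}$ is called $\lambda_t$-uniformly distributed if for all $c,d$ with $0\le c<d\le1$, $$\lim_{n\to\infty}\frac{\#\{k: 1\le k\le n,\ x_k\in[c,d]\cap C_t\}}{n}=d-c .$$ *)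

theory Defs
  imports "HOL-Analysis.Analysis"
begin

abbreviation continuum :: "nat set set" where
  "continuum \<equiv> UNIV"

(* Only the values X t for t in [0,1] are constrained or used. *)
definition almost_invariant_family :: "(real \<Rightarrow> real set) \<Rightarrow> bool" where
  "almost_invariant_family X \<longleftrightarrow>
     (\<forall>t\<in>{0..1}. \<forall>t'\<in>{0..1}. t \<noteq> t' \<longrightarrow> X t \<inter> X t' = {}) \<and>
     (\<forall>t\<in>{0..1}. \<forall>F. closed F \<and> emeasure lebesgue F > 0 \<longrightarrow> X t \<inter> F \<approx> continuum) \<and>
     (\<forall>I' g. I' \<subseteq> {0..1} \<longrightarrow>
        sym_diff ((+) g ` (\<Union>i\<in>I'. X i)) (\<Union>i\<in>I'. X i) \<prec> continuum)"

definition shift_invariant_sets :: "real set set \<Rightarrow> bool" where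
  "shift_invariant_sets \<A> \<longleftrightarrow> (\<forall>A\<in>\<A>. \<forall>g. (+) g ` A \<in> \<A>)"

definition S_generators :: "(real \<Rightarrow> real set) \<Rightarrow> real set set" where
  "S_generators X = sets lebesgue \<union> {A. A \<prec> continuum} \<union> X ` {0..1}"

definition S_real :: "(real \<Rightarrow> real set) \<Rightarrow> real set set" where
  "S_real X = \<Inter>{\<A>. sigma_algebra UNIV \<A> \<and> shift_invariant_sets \<A> \<and> S_generators X \<subseteq> \<A>}"

definition shift_invariant_measure :: "real measure \<Rightarrow> bool" where
  "shift_invariant_measure M \<longleftrightarrow>
     shift_invariant_sets (sets M) \<and>
     (\<forall>A\<in>sets M. \<forall>g. emeasure M ((+) g ` A) = emeasure M A)"

definition invariant_extension :: "(real \<Rightarrow> real set) \<Rightarrow> real \<Rightarrow> real measure \<Rightarrow> bool" where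
  "invariant_extension X t M \<longleftrightarrow>
     sets M = S_real X \<and>
     shift_invariant_measure M \<and>
     (\<forall>A\<in>sets lebesgue. emeasure M A = emeasure lebesgue A) \<and>
     emeasure M (UNIV - X t) = 0"

(* restrict_space has the traces Y \<inter> [0,1] with Y in S_real X as its sigma-algebra on [0,1]. *)
definition lambda_t :: "(real \<Rightarrow> real measure) \<Rightarrow> real \<Rightarrow> real measure" where
  "lambda_t \<mu> t = restrict_space (\<mu> t) {0..1}"

definition C_set :: "(real \<Rightarrow> real set) \<Rightarrow> real \<Rightarrow> real set" where
  "C_set X t = X t \<inter> {0..1}"

(* Sequences are indexed by 1, 2, ...; the value at index 0 is never used. *)
definition lambda_t_uniformly_distributed ::
    "(real \<Rightarrow> real set) \<Rightarrow> real \<Rightarrow> (nat \<Rightarrow> real) \<Rightarrow> bool" where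
  "lambda_t_uniformly_distributed X t x \<longleftrightarrow>
     (\<forall>c d. 0 \<le> c \<and> c < d \<and> d \<le> 1 \<longrightarrow>
        (\<lambda>n. real (card {k\<in>{1..n}. x k \<in> {c..d} \<inter> C_set X t}) / real n) \<longlonglongrightarrow> d - c)"

(* Functions on [0,1] are represented by functions on the reals whose values outside [0,1]
   are arbitrary. *)
definition C_t_functions :: "(real \<Rightarrow> real set) \<Rightarrow> real \<Rightarrow> (real \<Rightarrow> real) set" where
  "C_t_functions X t =
     {f. \<exists>h. continuous_on {0..1} h \<and> (\<forall>x\<in>{0..1}. f x = h x * indicator (C_set X t) x)}"

end

(* The sequence is studied through the weighted averages with weights w n = 1 if x n lies in C_t and
   w n = 0 otherwise.  Weyl's sandwich argument applies to such averages without change: continuous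
   functions are uniform limits of step functions, and indicators of intervals lie between continuous
   functions with nearly the same integral.  On the integral side C_t is invisible, because its
   complement is a null set of an extension of Lebesgue measure; so both sides of the criterion
   involve only the Lebesgue integral of h. *)
theory Submission
  imports Defs
begin

section \<open>Weighted averages along a sequence in [0,1] and the sandwich principle\<close>

locale weighted_sequence =
  fixes w x :: "nat \<Rightarrow> real"
  assumes weight_nonneg: "\<And>n. n \<ge> 1 \<Longrightarrow> 0 \<le> w n"
    and in_unit: "\<And>n. n \<ge> 1 \<Longrightarrow> x n \<in> {0..1}"
begin

definition average :: "(real \<Rightarrow> real) \<Rightarrow> nat \<Rightarrow> real" where
  "average g N = (1 / real N) * (\<Sum>n=1..N. w n * g (x n))"

text \<open>Integral and limit are bundled so that each closure rule below carries both at once.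
  \<open>has_integral\<close> asserts existence and value together, so no separate integrability
  hypotheses are needed.\<close>

definition averages_to :: "(real \<Rightarrow> real) \<Rightarrow> real \<Rightarrow> bool" where
  "averages_to g I \<longleftrightarrow> (g has_integral I) {0..1} \<and> average g \<longlonglongrightarrow> I"

lemma average_mono:
  assumes "\<And>y. y \<in> {0..1} \<Longrightarrow> f y \<le> g y"
  shows "average f N \<le> average g N"
  unfolding average_def
  by (intro mult_left_mono sum_mono) (auto intro!: mult_left_mono assms in_unit weight_nonneg)

lemma averages_to_add:
  assumes "averages_to f I" "averages_to g J"
  shows "averages_to (\<lambda>y. f y + g y) (I + J)"
proof -
  have "average (\<lambda>y. f y + g y) = (\<lambda>N. average f N + average g N)"
    by (simp add: average_def fun_eq_iff sum.distrib algebra_simps add_divide_distrib)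
  then show ?thesis
    using assms by (auto simp: averages_to_def intro!: has_integral_add tendsto_add)
qed

lemma averages_to_cmult:
  assumes "averages_to f I"
  shows "averages_to (\<lambda>y. c * f y) (c * I)"
proof -
  have "average (\<lambda>y. c * f y) = (\<lambda>N. c * average f N)"
    by (simp add: average_def fun_eq_iff sum_distrib_left mult_ac)
  then show ?thesis
    using assms by (auto simp: averages_to_def intro!: has_integral_mult_right tendsto_mult_left)
qed

lemma averages_to_diff:
  assumes "averages_to f I" "averages_to g J"
  shows "averages_to (\<lambda>y. f y - g y) (I - J)"
  using averages_to_add[OF assms(1) averages_to_cmult[OF assms(2), of "-1"]] by simp

lemma averages_to_zero: "averages_to (\<lambda>y. 0) 0"
  by (simp add: averages_to_def average_def [abs_def])

lemma averages_to_sum: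
  assumes "finite A" "\<And>i. i \<in> A \<Longrightarrow> averages_to (f i) (I i)"
  shows "averages_to (\<lambda>y. \<Sum>i\<in>A. f i y) (\<Sum>i\<in>A. I i)"
  using assms by (induction A rule: finite_induct) (auto intro: averages_to_zero averages_to_add)

text \<open>Integration and \<open>average\<close> are both monotone, the latter because the weights
  are nonnegative. Hence \<open>I\<close> lies between \<open>L\<close> and \<open>U\<close>, and
  the averages of \<open>g\<close> are eventually almost between them, so a small gap
  \<open>U - L\<close> forces convergence.\<close>

lemma averages_to_sandwich:
  assumes g: "(g has_integral I) {0..1}"
    and approx: "\<And>e. e > 0 \<Longrightarrow> \<exists>l u L U. averages_to l L \<and> averages_to u U \<and>
          (\<forall>y\<in>{0..1}. l y \<le> g y \<and> g y \<le> u y) \<and> U - L \<le> e"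
  shows "averages_to g I"
proof -
  have "average g \<longlonglongrightarrow> I"
  proof (rule LIMSEQ_I)
    fix r :: real assume "r > 0"
    \<comment> \<open>Half of \<open>r\<close> pays for the gap \<open>U - L\<close>, the other half
      for the distance of the averages of \<open>l\<close> and \<open>u\<close> from their
      limits.\<close>
    obtain l u L U where l: "averages_to l L" and u: "averages_to u U"
      and le: "\<And>y. y \<in> {0..1} \<Longrightarrow> l y \<le> g y" "\<And>y. y \<in> {0..1} \<Longrightarrow> g y \<le> u y"
      and UL: "U - L \<le> r / 2"
      using approx[of "r / 2"] \<open>r > 0\<close> by auto
    have LI: "L \<le> I" using l g le by (auto simp: averages_to_def intro: has_integral_le)
    have IU: "I \<le> U" using u g le by (auto simp: averages_to_def intro: has_integral_le)
    have "\<forall>\<^sub>F N in sequentially. L - r / 2 < average l N"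
      using l \<open>r > 0\<close> by (intro order_tendstoD(1)[where y = L]) (auto simp: averages_to_def)
    moreover have "\<forall>\<^sub>F N in sequentially. average u N < U + r / 2"
      using u \<open>r > 0\<close> by (intro order_tendstoD(2)[where y = U]) (auto simp: averages_to_def)
    ultimately have "\<forall>\<^sub>F N in sequentially. norm (average g N - I) < r"
    proof eventually_elim
      case (elim N)
      then show ?case
        using average_mono[of l g N] average_mono[of g u N] le LI IU UL by (auto simp: abs_less_iff)
    qed
    then show "\<exists>N. \<forall>n\<ge>N. norm (average g n - I) < r"
      by (simp add: eventually_sequentially)
  qed
  with g show ?thesis by (simp add: averages_to_def)
qed

end

lemma has_integral_indicator_subinterval:
  fixes a b :: real
  assumes "a \<le> b" "{a..b} \<subseteq> {c..d}"
  shows "(indicator {a..b} has_integral (b - a)) {c..d}"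
proof -
  have "((\<lambda>y. if y \<in> {a..b} then 1 else 0 :: real) has_integral (b - a)) {c..d}"
    using assms has_integral_const_real[of "1::real" a b] by (subst has_integral_restrict) auto
  then show ?thesis by (simp add: indicator_def [abs_def] of_bool_def)
qed

context weighted_sequence
begin

text \<open>The hypothesis covers only nondegenerate closed intervals. A point is squeezed between 0
  and arbitrarily short intervals around it; removing the right endpoint then gives half-open
  intervals, which can tile without overlap.\<close>

lemma
  assumes int: "\<And>c d. \<lbrakk>0 \<le> c; c < d; d \<le> 1\<rbrakk> \<Longrightarrow> averages_to (indicator {c..d}) (d - c)"
  shows averages_to_singleton: "p \<in> {0..1} \<Longrightarrow> averages_to (indicator {p}) 0"
    and averages_to_half_open:
      "\<lbrakk>0 \<le> c; c < d; d \<le> 1\<rbrakk> \<Longrightarrow> averages_to (indicator {c..<d}) (d - c)"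
proof -
  show single: "averages_to (indicator {p}) 0" if p: "p \<in> {0..1}" for p
  proof (rule averages_to_sandwich)
    show "(indicator {p} has_integral (0::real)) {0..1}"
      using has_integral_indicator_subinterval[of p p 0 1] p by simp
    fix e :: real assume "e > 0"
    \<comment> \<open>Clipping to [0,1] keeps the interval admissible for \<open>int\<close>, and it
      stays nondegenerate even when \<open>p\<close> is 0 or 1.\<close>
    define a where "a = max 0 (p - e / 2)"
    define b where "b = min 1 (p + e / 2)"
    have ab: "0 \<le> a" "a < b" "b \<le> 1" "p \<in> {a..b}" "b - a \<le> e"
      using p \<open>e > 0\<close> by (auto simp: a_def b_def)
    have "averages_to (indicator {a..b}) (b - a)" using int ab by blast
    moreover have "\<forall>y\<in>{0..1}. 0 \<le> (indicator {p} y :: real) \<and>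
        indicator {p} y \<le> (indicator {a..b} y :: real)"
      using ab by (auto simp: indicator_def)
    ultimately show "\<exists>l u L U. averages_to l L \<and> averages_to u U \<and>
          (\<forall>y\<in>{0..1}. l y \<le> indicator {p} y \<and> indicator {p} y \<le> u y) \<and> U - L \<le> e"
      using averages_to_zero ab
      by (intro exI[of _ "\<lambda>y. 0"] exI[of _ "indicator {a..b}"] exI[of _ 0] exI[of _ "b - a"]) auto
  qed
  show "averages_to (indicator {c..<d}) (d - c)" if "0 \<le> c" "c < d" "d \<le> 1"
  proof -
    have "(\<lambda>y. indicator {c..d} y - indicator {d} y) = (indicator {c..<d} :: real \<Rightarrow> real)"
      using that by (auto simp: indicator_def fun_eq_iff)
    with averages_to_diff[OF int single, of c d d] that show ?thesis by simp
  qed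
qed

text \<open>By uniform continuity, \<open>h\<close> is within \<open>e / 2\<close> of a step
  function on \<open>m\<close> equal cells, and a step function is a linear combination of
  indicators already under control.\<close>

lemma averages_to_continuous:
  assumes int: "\<And>c d. \<lbrakk>0 \<le> c; c < d; d \<le> 1\<rbrakk> \<Longrightarrow> averages_to (indicator {c..d}) (d - c)"
    and h: "continuous_on {0..1} h"
  shows "averages_to h (integral {0..1} h)"
proof (rule averages_to_sandwich)
  show "(h has_integral integral {0..1} h) {0..1}"
    using h by (intro integrable_integral integrable_continuous_real)
  fix e :: real assume "e > 0"
  have "uniformly_continuous_on {0..1} h"
    using h by (intro compact_uniformly_continuous) auto
  then obtain \<delta> where "\<delta> > 0"
    and \<delta>: "\<And>y z. \<lbrakk>y \<in> {0..1}; z \<in> {0..1}; dist y z < \<delta>\<rbrakk> \<Longrightarrow> dist (h y) (h z) < e / 2"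
    using \<open>e > 0\<close> unfolding uniformly_continuous_on_def by (metis half_gt_zero)
  obtain m :: nat where m: "m > 0" "1 / real m < \<delta>"
    using \<open>\<delta> > 0\<close> by (metis nat_approx_posE zero_less_Suc)
  define J where "J j = {real j / m..<real (Suc j) / m}" for j
  \<comment> \<open>The half-open cells cover only [0,1), so the endpoint 1 gets its own term; it
    contributes the summand \<open>h 1 * 0\<close> to the integral.\<close>
  define g where "g y = (\<Sum>j<m. h (j / m) * indicator (J j) y) + h 1 * indicator {1} y" for y
  define I where "I = (\<Sum>j<m. h (j / m) * (real (Suc j) / m - j / m)) + h 1 * 0"
  have g: "averages_to g I"
    unfolding g_def I_def J_def using m
    by (intro averages_to_add averages_to_sum averages_to_cmult
          averages_to_half_open averages_to_singleton int)
       (auto simp: divide_simps)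
  \<comment> \<open>The averages of the constant 1 are the means of the weights, and their
    convergence to 1 is not automatic. It is the case c = 0, d = 1 of the hypothesis, and it lets
    the step function be shifted by \<open>e / 2\<close> up and down.\<close>
  have one: "averages_to (indicator {0..1}) 1" using int[of 0 1] by simp
  have close: "\<bar>h y - g y\<bar> \<le> e / 2" if y: "y \<in> {0..1}" for y
  proof (cases "y = 1")
    case True
    have "y \<notin> J j" if "j < m" for j
      using that True m by (auto simp: J_def divide_simps)
    then have "g y = h y" by (simp add: g_def True)
    then show ?thesis using \<open>e > 0\<close> by simp
  next
    case False
    define i where "i = nat \<lfloor>m * y\<rfloor>"
    have i_le: "real i \<le> m * y" and i_gt: "m * y < real i + 1"
      using y by (auto simp: i_def)
    have "m * y < m" using y False m by simp
    with i_le have "i < m" by linarith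
    have J: "y \<in> J j \<longleftrightarrow> j = i" for j
    proof -
      have "y \<in> J j \<longleftrightarrow> real j \<le> m * y \<and> m * y < real j + 1"
        using m by (auto simp: J_def field_simps)
      also have "\<dots> \<longleftrightarrow> j = i" using i_le i_gt by linarith
      finally show ?thesis .
    qed
    have "g y = (\<Sum>j<m. if j = i then h (j / m) else 0)"
      unfolding g_def using False by (auto simp: indicator_def J intro!: sum.cong)
    also have "\<dots> = h (i / m)" using \<open>i < m\<close> by simp
    finally have g: "g y = h (i / m)" .
    have "dist y (i / m) < \<delta>"
    proof -
      have "real i / m \<le> y" "y < real i / m + 1 / m"
        using J[of i] by (auto simp: J_def add_divide_distrib)
      then show ?thesis using m by (simp add: dist_real_def)
    qed
    then have "dist (h y) (h (i / m)) < e / 2"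
      using y \<open>i < m\<close> by (intro \<delta>) auto
    then show ?thesis by (simp add: g dist_real_def)
  qed
  let ?l = "\<lambda>y. g y - e / 2 * indicator {0..1} y" and ?u = "\<lambda>y. g y + e / 2 * indicator {0..1} y"
  have "averages_to ?l (I - e / 2 * 1)" "averages_to ?u (I + e / 2 * 1)"
    by (intro averages_to_diff averages_to_add averages_to_cmult g one)+
  moreover have "?l y \<le> h y \<and> h y \<le> ?u y" if "y \<in> {0..1}" for y
    using close[OF that] that unfolding abs_le_iff by (simp add: algebra_simps)
  ultimately show "\<exists>l u L U. averages_to l L \<and> averages_to u U \<and>
          (\<forall>y\<in>{0..1}. l y \<le> h y \<and> h y \<le> u y) \<and> U - L \<le> e"
    by (intro exI[of _ ?l] exI[of _ ?u] exI[of _ "I - e / 2 * 1"] exI[of _ "I + e / 2 * 1"]) auto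
qed

text \<open>The indicator is enclosed between two continuous trapezoids: \<open>l\<close> vanishes
  outside [c,d] and is 1 on [c+\<delta>, d-\<delta>], while \<open>u\<close> is 1 on [c,d] and
  vanishes outside [c-\<delta>, d+\<delta>].\<close>

lemma averages_to_interval:
  assumes cont: "\<And>h. continuous_on {0..1} h \<Longrightarrow> averages_to h (integral {0..1} h)"
    and cd: "0 \<le> c" "c < d" "d \<le> 1"
  shows "averages_to (indicator {c..d}) (d - c)"
proof (rule averages_to_sandwich)
  show "(indicator {c..d} has_integral (d - c)) {0..1}"
    using cd by (intro has_integral_indicator_subinterval) auto
  fix e :: real assume "e > 0"
  \<comment> \<open>The two integrals will differ by at most \<open>4 * \<delta>\<close>, hence
    \<open>e / 4\<close>; the bound \<open>(d - c) / 2\<close> keeps the inner interval from being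
    inverted.\<close>
  define \<delta> where "\<delta> = min (e / 4) ((d - c) / 2)"
  have \<delta>: "\<delta> > 0" "4 * \<delta> \<le> e" "2 * \<delta> \<le> d - c"
    using \<open>e > 0\<close> cd by (auto simp: \<delta>_def min_def)
  define l where "l y = max 0 (min 1 (min (y - c) (d - y) / \<delta>))" for y
  define u where "u y = max 0 (min 1 (1 + min (y - c) (d - y) / \<delta>))" for y
  have cont_l: "continuous_on {0..1} l" and cont_u: "continuous_on {0..1} u"
    unfolding l_def u_def using \<delta>(1) by (auto intro!: continuous_intros)
  note l = cont[OF cont_l] and u = cont[OF cont_u]
  have "d - c - 2 * \<delta> \<le> integral {0..1} l"
  proof (rule has_integral_le)
    show "(indicator {c + \<delta>..d - \<delta>} has_integral (d - c - 2 * \<delta>)) {0..1}"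
      using has_integral_indicator_subinterval[of "c + \<delta>" "d - \<delta>" 0 1] \<delta> cd
      by (simp add: algebra_simps)
    show "(l has_integral integral {0..1} l) {0..1}" using l by (simp add: averages_to_def)
    show "indicator {c + \<delta>..d - \<delta>} y \<le> l y" for y
      using \<delta> by (auto simp: indicator_def l_def field_simps)
  qed
  \<comment> \<open>Comparison with an indicator replaces computing the integral of
    \<open>u\<close>. The enlarged interval is clipped because it may stick out of [0,1].\<close>
  moreover have "integral {0..1} u \<le> min 1 (d + \<delta>) - max 0 (c - \<delta>)"
  proof (rule has_integral_le)
    show "(indicator {max 0 (c - \<delta>)..min 1 (d + \<delta>)}
        has_integral (min 1 (d + \<delta>) - max 0 (c - \<delta>))) {0..1}"
      using \<delta> cd by (intro has_integral_indicator_subinterval) auto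
    show "(u has_integral integral {0..1} u) {0..1}" using u by (simp add: averages_to_def)
    show "u y \<le> indicator {max 0 (c - \<delta>)..min 1 (d + \<delta>)} y" if "y \<in> {0..1}" for y
      using that \<delta> by (auto simp: indicator_def u_def field_simps min_def)
  qed
  ultimately have "integral {0..1} u - integral {0..1} l \<le> e"
    using \<delta> by linarith
  moreover have "l y \<le> indicator {c..d} y \<and> indicator {c..d} y \<le> u y" for y
    using \<delta>(1) by (auto simp: indicator_def l_def u_def field_simps)
  ultimately show "\<exists>l u L U. averages_to l L \<and> averages_to u U \<and>
      (\<forall>y\<in>{0..1}. l y \<le> indicator {c..d} y \<and> indicator {c..d} y \<le> u y) \<and> U - L \<le> e"
    using l u by blast
qed

theorem weighted_Weyl_criterion:
  "(\<forall>c d. 0 \<le> c \<and> c < d \<and> d \<le> 1 \<longrightarrow> average (indicator {c..d}) \<longlonglongrightarrow> d - c) \<longleftrightarrow>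
   (\<forall>h. continuous_on {0..1} h \<longrightarrow> average h \<longlonglongrightarrow> integral {0..1} h)"
    (is "?L \<longleftrightarrow> ?R")
proof
  assume ?L
  then have "averages_to (indicator {c..d}) (d - c)" if "0 \<le> c" "c < d" "d \<le> 1" for c d
    using that by (auto simp: averages_to_def intro!: has_integral_indicator_subinterval)
  then show ?R
    using averages_to_continuous unfolding averages_to_def by blast
next
  assume ?R
  then have "averages_to h (integral {0..1} h)" if "continuous_on {0..1} h" for h
    using that by (auto simp: averages_to_def intro!: integrable_integral integrable_continuous_real)
  then show ?L
    using averages_to_interval unfolding averages_to_def by blast
qed

end

section \<open>Integration against \<open>lambda_t\<close>\<close>

lemma S_generators_subset_S_real: "S_generators X \<subseteq> S_real X"
  unfolding S_real_def by blast

text \<open>On [0,1], \<open>f\<close> and \<open>h\<close> can differ only off \<open>X t\<close>,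
  which is null for \<open>\<mu> t\<close>. What remains is the integral of a Lebesgue measurable
  function, on which the extension agrees with Lebesgue measure.\<close>

lemma integral_lambda_t:
  fixes f h :: "real \<Rightarrow> real"
  assumes ext: "invariant_extension X t (\<mu> t)" and t: "t \<in> {0..1}"
    and h: "continuous_on {0..1} h"
    and f: "\<And>y. y \<in> {0..1} \<Longrightarrow> f y = h y * indicator (C_set X t) y"
  shows "(\<integral>y. f y \<partial>lambda_t \<mu> t) = integral {0..1} h"
proof -
  let ?M = "\<mu> t" and ?h = "\<lambda>y. indicator {0..1} y *\<^sub>R h y"
  have sets_M: "sets ?M = S_real X" and null: "emeasure ?M (UNIV - X t) = 0"
    and emeas: "\<And>A. A \<in> sets lebesgue \<Longrightarrow> emeasure ?M A = emeasure lebesgue A"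
    using ext by (auto simp: invariant_extension_def)
  have leb: "sets lebesgue \<subseteq> sets ?M" and Xt: "X t \<in> sets ?M"
    using S_generators_subset_S_real[of X] t by (auto simp: sets_M S_generators_def)
  \<comment> \<open>The extension is specified through its measurable sets only; its space is
    recovered from the measurability of \<open>UNIV\<close>.\<close>
  have sp: "space ?M = UNIV"
    using leb sets.sets_into_space[of UNIV ?M] sets.top[of lebesgue] by force
  have h_borel: "?h \<in> borel_measurable borel"
    using h by (intro borel_measurable_continuous_on_indicator) auto
  have h_leb: "?h \<in> borel_measurable lebesgue"
    using h_borel by (intro measurable_completion) simp
  have h_M: "?h \<in> borel_measurable ?M"
    using h_leb leb sp by (auto simp: measurable_def)
  have I: "{0..1} \<in> sets ?M" using leb by auto
  have f_eq: "indicator {0..1} y *\<^sub>R f y = indicator (X t) y * ?h y" for y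
    using f[of y] by (auto simp: indicator_def C_set_def)
  have "(\<integral>y. f y \<partial>lambda_t \<mu> t) = (\<integral>y. indicator {0..1} y *\<^sub>R f y \<partial>?M)"
    unfolding lambda_t_def using I sp by (intro integral_restrict_space) auto
  also have "\<dots> = (\<integral>y. ?h y \<partial>?M)"
  proof (rule integral_cong_AE)
    show "(\<lambda>y. indicator {0..1} y *\<^sub>R f y) \<in> borel_measurable ?M"
      unfolding f_eq using h_M Xt by (intro borel_measurable_times borel_measurable_indicator)
    show "?h \<in> borel_measurable ?M" by (rule h_M)
    show "AE y in ?M. indicator {0..1} y *\<^sub>R f y = ?h y"
    proof (rule AE_I)
      show "{y \<in> space ?M. indicator {0..1} y *\<^sub>R f y \<noteq> ?h y} \<subseteq> UNIV - X t"
        unfolding f_eq by auto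
      show "UNIV - X t \<in> sets ?M" using Xt sp by (metis sets.compl_sets)
    qed (rule null)
  qed
  also have "\<dots> = (\<integral>y. ?h y \<partial>lebesgue)"
    using h_leb leb sp emeas by (intro integral_subalgebra[symmetric]) auto
  also have "\<dots> = integral {0..1} h"
  proof -
    \<comment> \<open>Since \<open>?h\<close> is Borel, completing the measure does not change its
      integral, and for \<open>h\<close> on [0,1] the Bochner and Henstock-Kurzweil integrals
      agree.\<close>
    have "set_integrable lborel {0..1} h"
      unfolding set_integrable_def using h by (intro borel_integrable_compact) auto
    then show ?thesis
      using h_borel set_borel_integral_eq_integral(2)[of "{0..1}" h]
      by (simp add: integral_completion set_lebesgue_integral_def)
  qed
  finally show ?thesis .
qed

section \<open>Transfer to \<open>lambda_t\<close>-uniform distribution\<close>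

theorem theorem3p14:
  fixes X :: "real \<Rightarrow> real set" and \<mu> :: "real \<Rightarrow> real measure"
    and t :: real and x :: "nat \<Rightarrow> real"
  assumes "almost_invariant_family X"
    and "\<And>s. s \<in> {0..1} \<Longrightarrow> invariant_extension X s (\<mu> s)"
    and "t \<in> {0..1}"
    and "\<And>n. n \<ge> 1 \<Longrightarrow> x n \<in> {0..1}"
  shows "lambda_t_uniformly_distributed X t x \<longleftrightarrow>
    (\<forall>f\<in>C_t_functions X t.
       (\<lambda>N. (1 / real N) * (\<Sum>n=1..N. f (x n))) \<longlonglongrightarrow> (\<integral>y. f y \<partial>lambda_t \<mu> t))"
proof -
  define w :: "nat \<Rightarrow> real" where "w n = indicator (C_set X t) (x n)" for n
  interpret weighted_sequence w x
    using assms(4) by unfold_locales (auto simp: w_def)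
  note integral_t = integral_lambda_t[of X t \<mu>, OF assms(2)[OF assms(3)] assms(3)]
  have avg_int: "(\<lambda>n. real (card {k\<in>{1..n}. x k \<in> {c..d} \<inter> C_set X t}) / real n)
      = average (indicator {c..d})" for c d
  proof
    fix n
    have "(\<Sum>k=1..n. w k * indicator {c..d} (x k)) =
        (\<Sum>k=1..n. if x k \<in> {c..d} \<inter> C_set X t then 1 else 0)"
      by (intro sum.cong) (auto simp: w_def indicator_def)
    also have "\<dots> = real (card {k\<in>{1..n}. x k \<in> {c..d} \<inter> C_set X t})"
      by (subst sum.inter_filter[symmetric]) auto
    finally show "real (card {k\<in>{1..n}. x k \<in> {c..d} \<inter> C_set X t}) / real n
        = average (indicator {c..d}) n"
      by (simp add: average_def)
  qed
  \<comment> \<open>Agreement on [0,1] suffices because the sum starts at n = 1, where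
    \<open>x n\<close> is known to lie in [0,1].\<close>
  have avg_fun: "(\<lambda>N. (1 / real N) * (\<Sum>n=1..N. f (x n))) = average h"
    if "\<And>y. y \<in> {0..1} \<Longrightarrow> f y = h y * indicator (C_set X t) y" for f h
  proof
    fix N
    have "(\<Sum>n=1..N. f (x n)) = (\<Sum>n=1..N. w n * h (x n))"
      using that assms(4) by (intro sum.cong) (auto simp: w_def)
    then show "(1 / real N) * (\<Sum>n=1..N. f (x n)) = average h N"
      by (simp add: average_def)
  qed
  \<comment> \<open>A member of \<open>C_t_functions X t\<close> is arbitrary outside [0,1], but
    neither its averages nor its integral depend on those values, so the quantifier can range over
    the continuous \<open>h\<close> instead.\<close>
  have "(\<forall>f\<in>C_t_functions X t.
       (\<lambda>N. (1 / real N) * (\<Sum>n=1..N. f (x n))) \<longlonglongrightarrow> (\<integral>y. f y \<partial>lambda_t \<mu> t)) \<longleftrightarrow>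
     (\<forall>h. continuous_on {0..1} h \<longrightarrow> average h \<longlonglongrightarrow> integral {0..1} h)"
    (is "?L \<longleftrightarrow> ?R")
  proof
    assume L: ?L
    show ?R
    proof (intro allI impI)
      fix h :: "real \<Rightarrow> real" assume h: "continuous_on {0..1} h"
      let ?f = "\<lambda>y. h y * indicator (C_set X t) y"
      have "?f \<in> C_t_functions X t" using h by (auto simp: C_t_functions_def)
      then show "average h \<longlonglongrightarrow> integral {0..1} h"
        using L avg_fun[of ?f h] integral_t[OF h, of ?f]
        by fastforce
    qed
  next
    assume R: ?R
    show ?L
    proof
      fix f assume "f \<in> C_t_functions X t"
      then obtain h where h: "continuous_on {0..1} h"
        and f: "\<And>y. y \<in> {0..1} \<Longrightarrow> f y = h y * indicator (C_set X t) y"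
        by (auto simp: C_t_functions_def)
      show "(\<lambda>N. (1 / real N) * (\<Sum>n=1..N. f (x n))) \<longlonglongrightarrow> (\<integral>y. f y \<partial>lambda_t \<mu> t)"
        using R h avg_fun[OF f] integral_t[OF h f] by simp
    qed
  qed
  then show ?thesis
    unfolding lambda_t_uniformly_distributed_def avg_int weighted_Weyl_criterion by simp
qed

end
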